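(* Let $G$ be a finitely generated group with word length $|\cdot|$ associated with a fixed finite symmetric generating set, let $\mathcal E$ be a superreflexive Banach space, let $\pi\colon G\to \mathrm{GL}(\mathcal E)$ be a uniformly bounded $c_0$-representation, and let $b\colon G\to\mathcal E$ be a $1$-cocycle for $\pi$. Then $$\limsup_{|g|\to\infty}\frac{\lVert b(g)\rVert}{|g|}=0.$$ Equivalently, every such $1$-cocycle has sublinear growth.
   Context: $G$ is a discrete group with a fixed finite symmetric generating set, and $|g|$ is the associated word length. The statement $\limsup_{|g|\to\infty}\lVert b(g)\rVert/|g|=0$ means: for every $\varepsilon>0$ there is $N$ such that $\lVert b(g)\rVert\le\varepsilon|g|$ for all $g\in G$ with $|g|\ge N$; this is what "sublinear growth" means. A representation $\pi\colon G\to\mathrm{GL}(\mathcal E)$ is a homomorphism into the group of bounded linear isomorphisms of the Banach space $\mathcal E$. It is uniformly bounded if there is $C>0$ with $\lVert\pi(g)\rVert\le C$ for all $g\in G$. It is a $c_0$-representation if for every $\xi\in\mathcal E$ and every $\varphi\in\mathcal E^*$ one has $\varphi(\pi(g)\xi)\to 0$ as $g\to\infty$ (i.e. as $g$ leaves every finite subset of $G$). A $1$-cocycle for $\pi$ is a map $b\colon G\to\mathcal E$ with $b(gh)=b(g)+\pi(g)b(h)$ for all $g,h\in G$. The modulus of convexity of a Banach space $\mathcal E$ is $\delta_{\mathcal E}(\varepsilon)=\inf\{1-\lVert\frac{x+y}{2}\rVert : \lVert x\rVert=\lVert y\rVert=1,\ \lVert x-y\rVert\ge\varepsilon\}$ for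 $0<\varepsilon\le 2$. $\mathcal E$ is uniformly convex if $\delta_{\mathcal E}(\varepsilon)>0$ for every such $\varepsilon>0$. $\mathcal E$ is superreflexive if it admits an equivalent uniformly convex norm. *)

theory Defs
  imports "HOL-Analysis.Analysis" "HOL-Algebra.Generated_Groups"
begin

definition symmetric_generating_set :: "('g, 'm) monoid_scheme \<Rightarrow> 'g set \<Rightarrow> bool" where
  "symmetric_generating_set G S \<longleftrightarrow>
     S \<subseteq> carrier G \<and> (\<forall>s\<in>S. inv\<^bsub>G\<^esub> s \<in> S) \<and> generate G S = carrier G"

definition word_length :: "('g, 'm) monoid_scheme \<Rightarrow> 'g set \<Rightarrow> 'g \<Rightarrow> nat" where
  "word_length G S g =
     (LEAST n. \<exists>w. length w = n \<and> set w \<subseteq> S \<and> foldr (mult G) w \<one>\<^bsub>G\<^esub> = g)"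

text \<open>The modulus of convexity is taken in the extended reals, so that the infimum over the
  empty set (which only occurs on the zero space) is \<open>\<infinity>\<close>.\<close>

definition modulus_of_convexity :: "('e::real_vector \<Rightarrow> real) \<Rightarrow> real \<Rightarrow> ereal" where
  "modulus_of_convexity N \<epsilon> =
     Inf {ereal (1 - N ((1 / 2) *\<^sub>R (x + y))) | x y. N x = 1 \<and> N y = 1 \<and> N (x - y) \<ge> \<epsilon>}"

definition uniformly_convex_norm :: "('e::real_vector \<Rightarrow> real) \<Rightarrow> bool" where
  "uniformly_convex_norm N \<longleftrightarrow> (\<forall>\<epsilon>. 0 < \<epsilon> \<and> \<epsilon> \<le> 2 \<longrightarrow> modulus_of_convexity N \<epsilon> > 0)"

definition is_norm :: "('e::real_vector \<Rightarrow> real) \<Rightarrow> bool" where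
  "is_norm N \<longleftrightarrow>
     (\<forall>x. N x \<ge> 0) \<and> (\<forall>x. N x = 0 \<longleftrightarrow> x = 0) \<and>
     (\<forall>a x. N (a *\<^sub>R x) = \<bar>a\<bar> * N x) \<and> (\<forall>x y. N (x + y) \<le> N x + N y)"

definition equivalent_norm :: "('e::real_normed_vector \<Rightarrow> real) \<Rightarrow> bool" where
  "equivalent_norm N \<longleftrightarrow>
     is_norm N \<and> (\<exists>c>0. \<exists>C>0. \<forall>x. c * norm x \<le> N x \<and> N x \<le> C * norm x)"

definition superreflexive :: "'e::banach itself \<Rightarrow> bool" where
  "superreflexive _ \<longleftrightarrow> (\<exists>N :: 'e \<Rightarrow> real. equivalent_norm N \<and> uniformly_convex_norm N)"

definition GL :: "('e::real_normed_vector \<Rightarrow>\<^sub>L 'e) monoid" where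
  "GL = units_of \<lparr>carrier = UNIV, mult = (o\<^sub>L), one = id_blinfun\<rparr>"

definition linear_representation ::
    "('g, 'm) monoid_scheme \<Rightarrow> ('g \<Rightarrow> 'e::real_normed_vector \<Rightarrow>\<^sub>L 'e) \<Rightarrow> bool" where
  "linear_representation G \<pi> \<longleftrightarrow> \<pi> \<in> hom G GL"

definition uniformly_bounded ::
    "('g, 'm) monoid_scheme \<Rightarrow> ('g \<Rightarrow> 'e::real_normed_vector \<Rightarrow>\<^sub>L 'e) \<Rightarrow> bool" where
  "uniformly_bounded G \<pi> \<longleftrightarrow> (\<exists>C>0. \<forall>g\<in>carrier G. norm (\<pi> g) \<le> C)"

text \<open>The filter below is the filter of cofinite subsets of \<^term>\<open>carrier G\<close>; it is trivial when
  the carrier is finite.\<close>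

definition c0_representation ::
    "('g, 'm) monoid_scheme \<Rightarrow> ('g \<Rightarrow> 'e::real_normed_vector \<Rightarrow>\<^sub>L 'e) \<Rightarrow> bool" where
  "c0_representation G \<pi> \<longleftrightarrow> linear_representation G \<pi> \<and>
     (\<forall>\<xi> (\<phi> :: 'e \<Rightarrow>\<^sub>L real).
        ((\<lambda>g. blinfun_apply \<phi> (blinfun_apply (\<pi> g) \<xi>)) \<longlongrightarrow> 0) (inf cofinite (principal (carrier G))))"

definition cocycle ::
    "('g, 'm) monoid_scheme \<Rightarrow> ('g \<Rightarrow> 'e::real_normed_vector \<Rightarrow>\<^sub>L 'e) \<Rightarrow> ('g \<Rightarrow> 'e) \<Rightarrow> bool" where
  "cocycle G \<pi> b \<longleftrightarrow>
     (\<forall>g\<in>carrier G. \<forall>h\<in>carrier G. b (g \<otimes>\<^bsub>G\<^esub> h) = b g + blinfun_apply (\<pi> g) (b h))"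

text \<open>The meaning of \<open>limsup \<parallel>b(g)\<parallel> / |g| = 0\<close> as \<open>|g| \<rightarrow> \<infinity>\<close>. The library's \<open>Limsup\<close> would be
  \<open>-\<infinity>\<close> for a finite group, where the filter is trivial.\<close>

definition sublinear_growth ::
    "('g, 'm) monoid_scheme \<Rightarrow> 'g set \<Rightarrow> ('g \<Rightarrow> 'e::real_normed_vector) \<Rightarrow> bool" where
  "sublinear_growth G S b \<longleftrightarrow>
     (\<forall>\<epsilon>>0. \<exists>N. \<forall>g\<in>carrier G. word_length G S g \<ge> N \<longrightarrow>
        norm (b g) \<le> \<epsilon> * real (word_length G S g))"

end

(*
  The norm sup_g N(\<pi>(g) x), with N uniformly convex, is
  \<pi>-invariant and still uniformly convex. Let c be the limsup of |b(g)|/|g| in this norm and suppose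
  c > 0. Fix n such that |b(h)| is at most slightly more than c n for |h| = n, take a very long g with
  |b(g)| almost c|g|, and cut a geodesic to g into blocks g_1, g_2, ... of length n. Then b(g) is the
  sum of the vectors \<pi>(g_1 ... g_{i-1}) b(g_i), none much longer than c n, so for every fixed K some
  two of them at distance K are almost aligned, hence close by uniform convexity. Translating back,
  b(h) is close to \<pi>(u) b(h') with |h| = |h'| = n and |u| = K n. A functional norming b(h) is then
  bounded away from 0 on \<pi>(u) b(h'); since h and h' range over a finite sphere, this contradicts the
  c_0 property once K is large.
*)
theory Submission
  imports Defs
begin

section \<open>Sublinear functionals\<close>

text \<open>Homogeneity is only demanded as an inequality; equality follows by rescaling.\<close>

definition sublinear_functional :: "('e::real_vector \<Rightarrow> real) \<Rightarrow> bool" where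
  "sublinear_functional p \<longleftrightarrow>
     (\<forall>x y. p (x + y) \<le> p x + p y) \<and> (\<forall>t x. 0 \<le> t \<longrightarrow> p (t *\<^sub>R x) \<le> t * p x)"

lemma sublinear_functional_add: "sublinear_functional p \<Longrightarrow> p (x + y) \<le> p x + p y"
  by (simp add: sublinear_functional_def)

lemma sublinear_functional_zero:
  assumes "sublinear_functional p" shows "p 0 = 0"
proof -
  have "p (0 + 0) \<le> p 0 + p 0" "p (0 *\<^sub>R 0) \<le> 0 * p 0"
    using assms unfolding sublinear_functional_def by blast+
  then show ?thesis by simp
qed

lemma sublinear_functional_scale:
  assumes "sublinear_functional p" "0 \<le> t"
  shows "p (t *\<^sub>R x) = t * p x"
proof (cases "t = 0")
  case True
  then show ?thesis using sublinear_functional_zero[OF assms(1)] by simp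
next
  case False
  with assms have t: "t > 0" by simp
  have "p (inverse t *\<^sub>R (t *\<^sub>R x)) \<le> inverse t * p (t *\<^sub>R x)"
    using assms t unfolding sublinear_functional_def by (meson inverse_nonnegative_iff_nonnegative)
  then have "t * p x \<le> p (t *\<^sub>R x)" using t by (simp add: field_simps)
  moreover have "p (t *\<^sub>R x) \<le> t * p x" using assms unfolding sublinear_functional_def by blast
  ultimately show ?thesis by simp
qed

lemma sublinear_functional_neg:
  assumes "sublinear_functional p" shows "- p (- x) \<le> p x"
  using sublinear_functional_add[OF assms, of x "- x"] sublinear_functional_zero[OF assms] by simp

text \<open>\<open>r\<close> lowers \<open>q\<close> so that \<open>- y\<close> costs at most
  \<open>- q y\<close> (take \<open>t = 1\<close> at \<open>x = - y\<close>) and stays sublinear. It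
  serves twice: to show that minimal functionals are odd, and to force equality at a prescribed
  \<open>y\<close>.\<close>

lemma sublinear_functional_lower:
  fixes q :: "'e::real_vector \<Rightarrow> real" and y :: 'e
  assumes "sublinear_functional q"
  defines "r \<equiv> (\<lambda>x. INF t\<in>{0..}. q (x + t *\<^sub>R y) - t * q y)"
  shows "sublinear_functional r" and "r x \<le> q x" and "r (- y) \<le> - q y"
proof -
  \<comment> \<open>A real infimum needs a lower bound; splitting \<open>t *\<^sub>R y\<close> as
    \<open>(x + t *\<^sub>R y) + (- x)\<close> gives one independent of \<open>t\<close>.\<close>
  have bdd: "bdd_below ((\<lambda>t. q (x + t *\<^sub>R y) - t * q y) ` {0..})" for x
  proof (rule bdd_belowI2)
    fix t :: real assume "t \<in> {0..}"
    then have "t * q y = q ((x + t *\<^sub>R y) + (- x))"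
      using sublinear_functional_scale[OF assms(1), of t y] by simp
    also have "\<dots> \<le> q (x + t *\<^sub>R y) + q (- x)" by (rule sublinear_functional_add[OF assms(1)])
    finally show "- q (- x) \<le> q (x + t *\<^sub>R y) - t * q y" by simp
  qed
  have r_le: "r x \<le> q (x + t *\<^sub>R y) - t * q y" if "0 \<le> t" for x t
    unfolding r_def by (rule cINF_lower[OF bdd]) (use that in simp)
  have r_ge: "a \<le> r x" if "\<And>t. 0 \<le> t \<Longrightarrow> a \<le> q (x + t *\<^sub>R y) - t * q y" for a x
    unfolding r_def by (rule cINF_greatest) (use that in auto)
  show "r x \<le> q x" using r_le[of 0 x] by simp
  show "r (- y) \<le> - q y" using r_le[of 1 "- y"] sublinear_functional_zero[OF assms(1)] by simp
  show "sublinear_functional r" unfolding sublinear_functional_def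
  proof (intro conjI allI impI)
    fix x z
    \<comment> \<open>The parameters \<open>s\<close> and \<open>t\<close> stay independent, so that
      the two infima can be taken one after the other.\<close>
    have *: "r (x + z) \<le> (q (x + s *\<^sub>R y) - s * q y) + (q (z + t *\<^sub>R y) - t * q y)"
      if "0 \<le> s" "0 \<le> t" for s t
    proof -
      have "r (x + z) \<le> q ((x + z) + (s + t) *\<^sub>R y) - (s + t) * q y" using that by (intro r_le) simp
      also have "q ((x + z) + (s + t) *\<^sub>R y) = q ((x + s *\<^sub>R y) + (z + t *\<^sub>R y))"
        by (simp add: algebra_simps)
      also have "\<dots> \<le> q (x + s *\<^sub>R y) + q (z + t *\<^sub>R y)" by (rule sublinear_functional_add[OF assms(1)])
      finally show ?thesis by (simp add: algebra_simps)
    qed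
    have "r (x + z) - (q (x + s *\<^sub>R y) - s * q y) \<le> r z" if "0 \<le> s" for s
      by (rule r_ge) (use *[OF that] in \<open>simp add: algebra_simps\<close>)
    then have "r (x + z) - r z \<le> r x"
      by (intro r_ge) (simp add: algebra_simps)
    then show "r (x + z) \<le> r x + r z" by simp
  next
    fix s :: real and x assume s: "0 \<le> s"
    show "r (s *\<^sub>R x) \<le> s * r x"
    proof (cases "s = 0")
      case True
      then show ?thesis using r_le[of 0 0] sublinear_functional_zero[OF assms(1)] by simp
    next
      case False
      with s have s: "s > 0" by simp
      have "r (s *\<^sub>R x) / s \<le> r x"
      proof (rule r_ge)
        fix t :: real assume t: "0 \<le> t"
        have "r (s *\<^sub>R x) \<le> q (s *\<^sub>R x + (s * t) *\<^sub>R y) - (s * t) * q y" using s t by (intro r_le) simp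
        also have "q (s *\<^sub>R x + (s * t) *\<^sub>R y) = q (s *\<^sub>R (x + t *\<^sub>R y))" by (simp add: algebra_simps)
        also have "\<dots> = s * q (x + t *\<^sub>R y)" using s by (intro sublinear_functional_scale[OF assms(1)]) simp
        finally show "r (s *\<^sub>R x) / s \<le> q (x + t *\<^sub>R y) - t * q y" using s by (simp add: field_simps)
      qed
      then show ?thesis using s by (simp add: field_simps)
    qed
  qed
qed

text \<open>Supplies the lower bounds for Zorn's lemma. Subadditivity comes from the chain
  condition: the smaller of \<open>q\<close> and \<open>r\<close> can be used at both points. The
  bound \<open>- p (- x)\<close> keeps the infimum finite.\<close>

lemma sublinear_functional_Inf_chain:
  fixes C :: "('e::real_vector \<Rightarrow> real) set"
  assumes "C \<noteq> {}" and sub: "\<And>q. q \<in> C \<Longrightarrow> sublinear_functional q \<and> q \<le> p"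
    and chain: "\<And>q r. q \<in> C \<Longrightarrow> r \<in> C \<Longrightarrow> q \<le> r \<or> r \<le> q"
  defines "m \<equiv> (\<lambda>x. INF q\<in>C. q x)"
  shows "sublinear_functional m" and "q \<in> C \<Longrightarrow> m \<le> q"
proof -
  have bdd: "bdd_below ((\<lambda>q. q x) ` C)" for x
  proof (rule bdd_belowI2)
    fix q assume "q \<in> C"
    with sub have "sublinear_functional q" "q (- x) \<le> p (- x)" by (auto simp: le_fun_def)
    then show "- p (- x) \<le> q x" using sublinear_functional_neg[of q x] by simp
  qed
  have m_le: "m x \<le> q x" if "q \<in> C" for q x
    unfolding m_def by (rule cINF_lower[OF bdd that])
  have m_ge: "a \<le> m x" if "\<And>q. q \<in> C \<Longrightarrow> a \<le> q x" for a x
    unfolding m_def by (rule cINF_greatest) (use assms that in auto)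
  show "q \<in> C \<Longrightarrow> m \<le> q" using m_le by (simp add: le_fun_def)
  show "sublinear_functional m" unfolding sublinear_functional_def
  proof (intro conjI allI impI)
    fix x z
    have *: "m (x + z) \<le> q x + r z" if qr: "q \<in> C" "r \<in> C" for q r
    proof -
      obtain l where l: "l \<in> C" "l \<le> q" "l \<le> r" using chain[OF qr] qr by blast
      have "m (x + z) \<le> l (x + z)" by (rule m_le[OF l(1)])
      also have "\<dots> \<le> l x + l z" using sub[OF l(1)] by (simp add: sublinear_functional_add)
      also have "\<dots> \<le> q x + r z" using l by (intro add_mono) (auto simp: le_fun_def)
      finally show ?thesis .
    qed
    have "m (x + z) - q x \<le> m z" if "q \<in> C" for q
      by (rule m_ge) (use *[OF that] in \<open>simp add: algebra_simps\<close>)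
    then have "m (x + z) - m z \<le> m x"
      by (intro m_ge) (simp add: algebra_simps)
    then show "m (x + z) \<le> m x + m z" by simp
  next
    fix s :: real and x assume s: "0 \<le> s"
    show "m (s *\<^sub>R x) \<le> s * m x"
    proof (cases "s = 0")
      case True
      obtain q where q: "q \<in> C" using assms(1) by blast
      with sub have "q 0 = 0" by (simp add: sublinear_functional_zero)
      with True show ?thesis using m_le[OF q, of 0] by simp
    next
      case False
      with s have s: "s > 0" by simp
      have "m (s *\<^sub>R x) / s \<le> m x"
      proof (rule m_ge)
        fix q assume q: "q \<in> C"
        have "m (s *\<^sub>R x) \<le> q (s *\<^sub>R x)" by (rule m_le[OF q])
        also have "\<dots> = s * q x" using s sub[OF q] by (intro sublinear_functional_scale) auto
        finally show "m (s *\<^sub>R x) / s \<le> q x" using s by (simp add: field_simps)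
      qed
      then show ?thesis using s by (simp add: field_simps)
    qed
  qed
qed

text \<open>By minimality, lowering along any \<open>y\<close> changes nothing, so
  \<open>q (- y) \<le> - q y\<close> and \<open>q\<close> is odd. Oddness turns subadditivity into
  additivity and extends homogeneity to negative scalars.\<close>

lemma minimal_sublinear_functional_linear:
  assumes q: "sublinear_functional q"
    and min: "\<And>r. sublinear_functional r \<Longrightarrow> r \<le> q \<Longrightarrow> r = q"
  shows "linear q"
proof -
  have neg: "q (- y) = - q y" for y
  proof -
    define r where "r = (\<lambda>x. INF t\<in>{0..}. q (x + t *\<^sub>R y) - t * q y)"
    have "r = q" using min sublinear_functional_lower(1,2)[OF q, where y = y] by (simp add: r_def le_fun_def)
    moreover have "r (- y) \<le> - q y" using sublinear_functional_lower(3)[OF q, where y = y] by (simp add: r_def)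
    ultimately have "q (- y) \<le> - q y" by simp
    then show ?thesis using sublinear_functional_neg[OF q, of y] by simp
  qed
  have "q (x + y) = q x + q y" for x y
    using sublinear_functional_add[OF q, of x y] sublinear_functional_add[OF q, of "x + y" "- y"] neg[of y] by simp
  moreover have "q (t *\<^sub>R x) = t *\<^sub>R q x" for t x
    using sublinear_functional_scale[OF q, of t x] sublinear_functional_scale[OF q, of "- t" x]
      neg[of "t *\<^sub>R x"] by (cases "0 \<le> t") auto
  ultimately show ?thesis by (rule linearI)
qed

section \<open>The Hahn-Banach theorem for sublinear functionals\<close>

theorem Hahn_Banach_sublinear_functional:
  fixes p :: "'e::real_vector \<Rightarrow> real"
  assumes p: "sublinear_functional p"
  shows "\<exists>\<phi>. linear \<phi> \<and> (\<forall>x. \<phi> x \<le> p x)"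
proof -
  define A where "A = {q. sublinear_functional q \<and> q \<le> p}"
  \<comment> \<open>Zorn's lemma is applied to the reversed pointwise order, so its maximal element
    is a minimal sublinear functional below \<open>p\<close>.\<close>
  have "\<exists>m\<in>A. \<forall>a\<in>A. a \<le> m \<longrightarrow> a = m"
  proof (rule predicate_Zorn)
    show "partial_order_on A (relation_of (\<lambda>q r. r \<le> q) A)"
      by (rule partial_order_on_relation_ofI) auto
    fix C assume "C \<in> Chains (relation_of (\<lambda>q r. r \<le> q) A)"
    then have C: "C \<subseteq> A" "\<And>q r. q \<in> C \<Longrightarrow> r \<in> C \<Longrightarrow> q \<le> r \<or> r \<le> q"
      by (auto simp: Chains_def relation_of_def)
    show "\<exists>u\<in>A. \<forall>a\<in>C. u \<le> a"
    proof (cases "C = {}")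
      case True
      then show ?thesis using p by (auto simp: A_def)
    next
      case False
      have sub: "\<And>q. q \<in> C \<Longrightarrow> sublinear_functional q \<and> q \<le> p" using C(1) by (auto simp: A_def)
      note inf = sublinear_functional_Inf_chain[OF False sub C(2)]
      obtain q where "q \<in> C" using False by blast
      with inf sub have "(\<lambda>x. INF q\<in>C. q x) \<in> A" unfolding A_def by (blast intro: order_trans)
      with inf(2) show ?thesis by blast
    qed
  qed
  then obtain m where m: "m \<in> A" "\<And>a. a \<in> A \<Longrightarrow> a \<le> m \<Longrightarrow> a = m" by blast
  have "linear m"
    by (rule minimal_sublinear_functional_linear) (use m in \<open>auto simp: A_def intro: order_trans\<close>)
  with m show ?thesis by (auto simp: A_def le_fun_def)
qed

text \<open>A linear functional below the lowering of \<open>p\<close> along \<open>y\<close>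
  satisfies \<open>\<phi> (- y) \<le> - p y\<close>, that is \<open>p y \<le> \<phi> y\<close>;
  domination by \<open>p\<close> gives the other inequality.\<close>

corollary Hahn_Banach_norming:
  fixes p :: "'e::real_vector \<Rightarrow> real"
  assumes p: "sublinear_functional p"
  shows "\<exists>\<phi>. linear \<phi> \<and> (\<forall>x. \<phi> x \<le> p x) \<and> \<phi> y = p y"
proof -
  note r = sublinear_functional_lower[OF p, where y = y]
  obtain \<phi> where \<phi>: "linear \<phi>" "\<And>x. \<phi> x \<le> (INF t\<in>{0..}. p (x + t *\<^sub>R y) - t * p y)"
    using Hahn_Banach_sublinear_functional[OF r(1)] by blast
  have le: "\<phi> x \<le> p x" for x using \<phi>(2) r(2) by (rule order_trans)
  have "- \<phi> y = \<phi> (- y)" using \<phi>(1) by (simp add: linear_neg)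
  also have "\<dots> \<le> - p y" using \<phi>(2) r(3) by (rule order_trans)
  finally show ?thesis using \<phi>(1) le by (intro exI[of _ \<phi>]) (auto intro: antisym)
qed

section \<open>Uniform convexity and invariant norms\<close>

lemma is_norm_sublinear: "is_norm N \<Longrightarrow> sublinear_functional N"
  unfolding is_norm_def sublinear_functional_def by (metis abs_of_nonneg order_refl)

lemma is_norm_minus: "is_norm N \<Longrightarrow> N (- x) = N x"
  unfolding is_norm_def by (metis abs_minus_cancel abs_one mult_1 scaleR_minus1_left)

lemma is_norm_sum:
  assumes "is_norm N" shows "N (\<Sum>i<n::nat. f i) \<le> (\<Sum>i<n. N (f i))"
proof (induction n)
  case 0
  have "N 0 = 0" using assms unfolding is_norm_def by blast
  then show ?case by simp
next
  case (Suc n)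
  have "N ((\<Sum>i<n. f i) + f n) \<le> N (\<Sum>i<n. f i) + N (f n)" using assms unfolding is_norm_def by blast
  with Suc show ?case by simp
qed

text \<open>Stated on the ball rather than the sphere because for a supremum of norms, a bound by 1
  holds for each of them, while the value 1 need not be taken by any of them.\<close>

definition uniformly_convex_ball :: "('e::real_vector \<Rightarrow> real) \<Rightarrow> bool" where
  "uniformly_convex_ball N \<longleftrightarrow> (\<forall>\<epsilon>>0. \<exists>\<delta>>0. \<forall>x y.
     N x \<le> 1 \<longrightarrow> N y \<le> 1 \<longrightarrow> N (x - y) \<ge> \<epsilon> \<longrightarrow> N (x + y) \<le> 2 - \<delta>)"

text \<open>The modulus is extended real and may be infinite, so a real number strictly between 0
  and it is chosen; the factor 2 undoes the midpoint.\<close>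

lemma uniformly_convex_normD:
  assumes "is_norm N" "uniformly_convex_norm N" "0 < \<epsilon>" "\<epsilon> \<le> 2"
  shows "\<exists>\<delta>>0. \<forall>x y. N x = 1 \<longrightarrow> N y = 1 \<longrightarrow> N (x - y) \<ge> \<epsilon> \<longrightarrow> N (x + y) \<le> 2 - \<delta>"
proof -
  have "modulus_of_convexity N \<epsilon> > ereal 0"
    using assms unfolding uniformly_convex_norm_def by (simp add: zero_ereal_def)
  then obtain z where z: "ereal 0 < ereal z" "ereal z < modulus_of_convexity N \<epsilon>"
    using ereal_dense2 by blast
  have "N (x + y) \<le> 2 - 2 * z" if "N x = 1" "N y = 1" "N (x - y) \<ge> \<epsilon>" for x y
  proof -
    have "modulus_of_convexity N \<epsilon> \<le> ereal (1 - N ((1 / 2) *\<^sub>R (x + y)))"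
      unfolding modulus_of_convexity_def by (rule Inf_lower) (use that in blast)
    with z(2) have "ereal z < ereal (1 - N ((1 / 2) *\<^sub>R (x + y)))" by (rule less_le_trans)
    moreover have "N ((1 / 2) *\<^sub>R (x + y)) = 1 / 2 * N (x + y)"
      using assms(1) unfolding is_norm_def by (metis abs_of_nonneg zero_le_divide_1_iff zero_le_numeral)
    ultimately show ?thesis by simp
  qed
  with z(1) show ?thesis by (intro exI[of _ "2 * z"]) auto
qed

text \<open>If \<open>N (x + y)\<close> is close to 2, both vectors lie close to the unit sphere, so
  normalizing moves them little and reduces the claim to unit vectors.\<close>

lemma uniformly_convex_ballI:
  assumes N: "is_norm N" and uc: "uniformly_convex_norm N"
  shows "uniformly_convex_ball N"
  unfolding uniformly_convex_ball_def
proof (intro allI impI)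
  fix \<epsilon>0 :: real assume "\<epsilon>0 > 0"
  \<comment> \<open>Uniform convexity of the norm speaks of separations up to 2 only; the cap covers
    larger ones.\<close>
  define \<epsilon> where "\<epsilon> = min \<epsilon>0 2"
  have \<epsilon>: "0 < \<epsilon>" "\<epsilon> \<le> 2" "\<epsilon> \<le> \<epsilon>0" using \<open>\<epsilon>0 > 0\<close> by (auto simp: \<epsilon>_def)
  obtain \<delta>0 where \<delta>0: "\<delta>0 > 0"
    "\<And>x y. N x = 1 \<Longrightarrow> N y = 1 \<Longrightarrow> N (x - y) \<ge> \<epsilon> / 2 \<Longrightarrow> N (x + y) \<le> 2 - \<delta>0"
    using uniformly_convex_normD[OF N uc, of "\<epsilon> / 2"] \<epsilon> by auto
  \<comment> \<open>Normalizing moves each vector by less than \<delta>. The bound \<epsilon>/4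
    leaves the unit vectors at least \<epsilon>/2 apart, and \<delta>0/4 keeps the total error
    2\<delta> below \<delta>0 - \<delta>.\<close>
  define \<delta> where "\<delta> = min (\<delta>0 / 4) (\<epsilon> / 4)"
  have \<delta>: "\<delta> > 0" "4 * \<delta> \<le> \<delta>0" "4 * \<delta> \<le> \<epsilon>" using \<delta>0 \<epsilon> by (auto simp: \<delta>_def)
  have tri: "N (u + v) \<le> N u + N v" for u v using N by (simp add: is_norm_def)
  have normalize: "N (inverse (N u) *\<^sub>R u) = 1 \<and> N (inverse (N u) *\<^sub>R u - u) < \<delta>"
    if "N u \<le> 1" "N u > 1 - \<delta>" for u
  proof -
    have pos: "N u > 0" using that \<delta> \<epsilon> by linarith
    have sc: "N (a *\<^sub>R u) = \<bar>a\<bar> * N u" for a using N by (simp add: is_norm_def)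
    have "inverse (N u) *\<^sub>R u - u = (inverse (N u) - 1) *\<^sub>R u" by (simp add: algebra_simps)
    moreover have "inverse (N u) \<ge> 1" using pos that by (simp add: one_le_inverse)
    ultimately have "N (inverse (N u) *\<^sub>R u - u) = (inverse (N u) - 1) * N u" by (simp only: sc)
    then have "N (inverse (N u) *\<^sub>R u - u) = 1 - N u" using pos by (simp add: left_diff_distrib)
    with that sc pos show ?thesis by simp
  qed
  have "N (x + y) \<le> 2 - \<delta>" if xy: "N x \<le> 1" "N y \<le> 1" "N (x - y) \<ge> \<epsilon>0" for x y
  proof (rule ccontr)
    assume "\<not> N (x + y) \<le> 2 - \<delta>"
    then have big: "N (x + y) > 2 - \<delta>" by simp
    with tri[of x y] xy have "N x > 1 - \<delta>" "N y > 1 - \<delta>" by linarith+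
    define x' y' where "x' = inverse (N x) *\<^sub>R x" and "y' = inverse (N y) *\<^sub>R y"
    have x': "N x' = 1" "N (x' - x) < \<delta>" and y': "N y' = 1" "N (y' - y) < \<delta>"
      using normalize[of x] normalize[of y] xy \<open>N x > 1 - \<delta>\<close> \<open>N y > 1 - \<delta>\<close> by (auto simp: x'_def y'_def)
    have sym: "N (u - v) = N (v - u)" for u v using is_norm_minus[OF N, of "u - v"] by simp
    have "N (x - y) \<le> N (x - x') + N (x' - y') + N (y' - y)"
      using tri[of "x - x'" "x' - y"] tri[of "x' - y'" "y' - y"] by simp
    then have "N (x' - y') \<ge> \<epsilon> / 2" using xy(3) \<epsilon> \<delta> x' y' sym[of x x'] by linarith
    then have "N (x' + y') \<le> 2 - \<delta>0" using \<delta>0(2) x' y' by blast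
    moreover have "N (x + y) \<le> N (x - x') + N (x' + y') + N (y - y')"
      using tri[of "x - x'" "x' + y"] tri[of "x' + y'" "y - y'"] by simp
    ultimately show False using big \<delta> x' y' sym[of x x'] sym[of y y'] by linarith
  qed
  with \<delta>(1) show "\<exists>\<delta>>0. \<forall>x y. N x \<le> 1 \<longrightarrow> N y \<le> 1 \<longrightarrow> N (x - y) \<ge> \<epsilon>0 \<longrightarrow> N (x + y) \<le> 2 - \<delta>"
    by blast
qed

text \<open>Rescale by \<open>inverse A\<close>. It matters that one \<delta> works for all
  \<open>A\<close>: later \<open>A\<close> is chosen after \<delta>.\<close>

lemma uniformly_convex_ball_scaled:
  assumes N: "is_norm N" and uc: "uniformly_convex_ball N" and "\<epsilon> > 0"
  shows "\<exists>\<delta>>0. \<forall>A x y. A > 0 \<longrightarrow> N x \<le> A \<longrightarrow> N y \<le> A \<longrightarrow> N (x - y) \<ge> \<epsilon> * A \<longrightarrow> N (x + y) \<le> (2 - \<delta>) * A"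
proof -
  obtain \<delta> where \<delta>: "\<delta> > 0" "\<And>x y. N x \<le> 1 \<Longrightarrow> N y \<le> 1 \<Longrightarrow> N (x - y) \<ge> \<epsilon> \<Longrightarrow> N (x + y) \<le> 2 - \<delta>"
    using uc \<open>\<epsilon> > 0\<close> unfolding uniformly_convex_ball_def by blast
  have "N (x + y) \<le> (2 - \<delta>) * A" if A: "A > 0" "N x \<le> A" "N y \<le> A" "N (x - y) \<ge> \<epsilon> * A" for A x y
  proof -
    define s where "s = inverse A"
    have s: "s > 0" "s * A = 1" using A(1) by (auto simp: s_def)
    have sc: "N (s *\<^sub>R z) = s * N z" for z using N s(1) by (simp add: is_norm_def)
    have "N (s *\<^sub>R x + s *\<^sub>R y) \<le> 2 - \<delta>"
    proof (rule \<delta>(2))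
      show "N (s *\<^sub>R x) \<le> 1" "N (s *\<^sub>R y) \<le> 1"
        using A(2,3) mult_left_mono[of _ A s] s by (auto simp: sc)
      have "s *\<^sub>R x - s *\<^sub>R y = s *\<^sub>R (x - y)" by (simp add: scaleR_diff_right)
      then show "\<epsilon> \<le> N (s *\<^sub>R x - s *\<^sub>R y)"
        using mult_left_mono[OF A(4), of s] s by (simp add: sc mult.left_commute)
    qed
    moreover have "s *\<^sub>R x + s *\<^sub>R y = s *\<^sub>R (x + y)" by (simp add: scaleR_add_right)
    ultimately have "s * N (x + y) \<le> 2 - \<delta>" by (simp add: sc)
    then show ?thesis using A(1) by (simp add: s_def field_simps)
  qed
  with \<delta>(1) show ?thesis by blast
qed

section \<open>Invariant renorming for uniformly bounded representations\<close>

lemma linear_representation_mult: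
  assumes "linear_representation G \<pi>" "g \<in> carrier G" "h \<in> carrier G"
  shows "blinfun_apply (\<pi> (g \<otimes>\<^bsub>G\<^esub> h)) x = blinfun_apply (\<pi> g) (blinfun_apply (\<pi> h) x)"
  using assms unfolding linear_representation_def hom_def GL_def units_of_def by simp

text \<open>\<open>hom\<close> demands multiplicativity only. It makes the image of the neutral
  element idempotent, and as a member of \<open>GL\<close> this image has a left inverse.\<close>

lemma linear_representation_one:
  fixes \<pi> :: "'g \<Rightarrow> 'e::real_normed_vector \<Rightarrow>\<^sub>L 'e"
  assumes "group G" "linear_representation G \<pi>"
  shows "blinfun_apply (\<pi> \<one>\<^bsub>G\<^esub>) x = x"
proof -
  interpret group G by fact
  have "\<pi> \<one>\<^bsub>G\<^esub> \<in> carrier GL" using assms(2) unfolding linear_representation_def hom_def by blast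
  then obtain T where T: "T o\<^sub>L \<pi> \<one>\<^bsub>G\<^esub> = id_blinfun"
    unfolding GL_def units_of_def Units_def by auto
  then have inv: "blinfun_apply T (blinfun_apply (\<pi> \<one>\<^bsub>G\<^esub>) y) = y" for y
    by (metis blinfun_apply_blinfun_compose blinfun_apply_id_blinfun id_apply)
  have "blinfun_apply (\<pi> \<one>\<^bsub>G\<^esub>) (blinfun_apply (\<pi> \<one>\<^bsub>G\<^esub>) x) = blinfun_apply (\<pi> \<one>\<^bsub>G\<^esub>) x"
    using linear_representation_mult[OF assms(2), of "\<one>\<^bsub>G\<^esub>" "\<one>\<^bsub>G\<^esub>" x] by simp
  then show ?thesis using inv by metis
qed

definition orbit_norm ::
    "('g, 'm) monoid_scheme \<Rightarrow> ('g \<Rightarrow> 'e::real_normed_vector \<Rightarrow>\<^sub>L 'e) \<Rightarrow> ('e \<Rightarrow> real) \<Rightarrow> 'e \<Rightarrow> real" where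
  "orbit_norm G \<pi> N x = (SUP g\<in>carrier G. N (blinfun_apply (\<pi> g) x))"

text \<open>Uniform boundedness makes the supremum finite and comparable to the norm. Uniform
  convexity survives because the ball estimate for \<open>N\<close> applies to
  \<open>\<pi> g x\<close> and \<open>\<pi> g y\<close> with the same \<delta> for all
  \<open>g\<close>. Invariance is the inequality \<open>M (\<pi> g x) \<le> M x\<close> used for
  \<open>g\<close> and its inverse.\<close>

lemma orbit_norm_properties:
  fixes \<pi> :: "'g \<Rightarrow> 'e::real_normed_vector \<Rightarrow>\<^sub>L 'e"
  assumes G: "group G" and \<pi>: "linear_representation G \<pi>" and ub: "uniformly_bounded G \<pi>"
    and eq: "equivalent_norm N" and uc: "uniformly_convex_ball N"
  defines "M \<equiv> orbit_norm G \<pi> N"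
  shows "equivalent_norm M" and "uniformly_convex_ball M"
    and "g \<in> carrier G \<Longrightarrow> M (blinfun_apply (\<pi> g) x) = M x"
proof -
  interpret group G by fact
  note mult = linear_representation_mult[OF \<pi>] and one = linear_representation_one[OF G \<pi>]
  obtain K where K: "K > 0" "\<And>g. g \<in> carrier G \<Longrightarrow> norm (\<pi> g) \<le> K"
    using ub unfolding uniformly_bounded_def by blast
  have N: "is_norm N" using eq by (simp add: equivalent_norm_def)
  obtain c C where cC: "c > 0" "C > 0" "\<And>x. c * norm x \<le> N x" "\<And>x. N x \<le> C * norm x"
    using eq unfolding equivalent_norm_def by blast
  have \<pi>K: "norm (\<pi> g x) \<le> K * norm x" if "g \<in> carrier G" for g x
    using norm_blinfun[of "\<pi> g" x] mult_right_mono[OF K(2)[OF that] norm_ge_zero[of x]] by linarith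
  have up: "N (\<pi> g x) \<le> C * K * norm x" if "g \<in> carrier G" for g x
  proof -
    have "C * norm (\<pi> g x) \<le> C * (K * norm x)" using \<pi>K[OF that] cC(2) by (intro mult_left_mono) auto
    with cC(4)[of "\<pi> g x"] show ?thesis by (simp only: mult.assoc order_trans)
  qed
  have bdd: "bdd_above ((\<lambda>g. N (\<pi> g x)) ` carrier G)" for x
    by (rule bdd_aboveI2) (rule up)
  have M_ge: "N (\<pi> g x) \<le> M x" if "g \<in> carrier G" for g x
    unfolding M_def orbit_norm_def by (rule cSUP_upper[OF that bdd])
  have M_le: "M x \<le> a" if "\<And>g. g \<in> carrier G \<Longrightarrow> N (\<pi> g x) \<le> a" for a x
    unfolding M_def orbit_norm_def by (rule cSUP_least) (use that in auto)
  have NM: "N x \<le> M x" for x using M_ge[of "\<one>\<^bsub>G\<^esub>" x] by (simp add: one)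
  have M_up: "M x \<le> C * K * norm x" for x by (rule M_le) (rule up)
  have low: "norm x \<le> K * norm (\<pi> g x)" if "g \<in> carrier G" for g x
    using \<pi>K[of "inv\<^bsub>G\<^esub> g" "\<pi> g x"] mult[of "inv\<^bsub>G\<^esub> g" g x] that by (simp add: one)
  have M_scale_le: "M (a *\<^sub>R x) \<le> \<bar>a\<bar> * M x" for a x
  proof (rule M_le)
    fix g assume g: "g \<in> carrier G"
    have "N (\<pi> g (a *\<^sub>R x)) = \<bar>a\<bar> * N (\<pi> g x)"
      using N by (simp add: blinfun.scaleR_right is_norm_def)
    then show "N (\<pi> g (a *\<^sub>R x)) \<le> \<bar>a\<bar> * M x" using M_ge[OF g] by (simp add: mult_left_mono)
  qed
  have N0: "0 \<le> N x" "N x = 0 \<longleftrightarrow> x = 0" for x using N by (auto simp: is_norm_def)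
  have norm: "is_norm M" unfolding is_norm_def
  proof (intro conjI allI)
    show M0: "0 \<le> M x" for x using NM[of x] N0(1)[of x] by linarith
    show "M x = 0 \<longleftrightarrow> x = 0" for x
    proof
      assume "M x = 0"
      with NM[of x] N0[of x] show "x = 0" by simp
    next
      assume "x = 0"
      with M_up[of x] M0[of x] show "M x = 0" by simp
    qed
    show "M (a *\<^sub>R x) = \<bar>a\<bar> * M x" for a x
    proof (cases "a = 0")
      case True
      then show ?thesis using M_scale_le[of 0 x] M0[of 0] by simp
    next
      case False
      then have "M x \<le> \<bar>inverse a\<bar> * M (a *\<^sub>R x)" using M_scale_le[of "inverse a" "a *\<^sub>R x"] by simp
      with False have "\<bar>a\<bar> * M x \<le> M (a *\<^sub>R x)" by (simp add: field_simps abs_inverse)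
      with M_scale_le[of a x] show ?thesis by simp
    qed
    show "M (x + y) \<le> M x + M y" for x y
    proof (rule M_le)
      fix g assume g: "g \<in> carrier G"
      have "N (\<pi> g (x + y)) \<le> N (\<pi> g x) + N (\<pi> g y)"
        using N by (simp add: blinfun.add_right is_norm_def)
      then show "N (\<pi> g (x + y)) \<le> M x + M y" using M_ge[OF g, of x] M_ge[OF g, of y] by linarith
    qed
  qed
  have "c * norm x \<le> M x" for x using cC(3) NM by (rule order_trans)
  moreover have "C * K > 0" using cC K by simp
  ultimately show "equivalent_norm M" unfolding equivalent_norm_def using norm cC(1) M_up by blast
  show "uniformly_convex_ball M" unfolding uniformly_convex_ball_def
  proof (intro allI impI)
    fix \<epsilon> :: real assume "\<epsilon> > 0"
    \<comment> \<open>By \<open>low\<close>, \<open>\<pi> g\<close> shrinks the norm by at most the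
      factor \<open>K\<close>, so a separation \<epsilon> in \<open>M\<close> forces the separation
      \<epsilon>' in \<open>N\<close> after applying \<open>\<pi> g\<close>, for every
      \<open>g\<close> and not only for those that nearly attain the supremum.\<close>
    define \<epsilon>' where "\<epsilon>' = c * \<epsilon> / (C * K * K)"
    have "\<epsilon>' > 0" using \<open>\<epsilon> > 0\<close> cC K by (simp add: \<epsilon>'_def)
    then obtain \<delta> where \<delta>: "\<delta> > 0" "\<And>x y. N x \<le> 1 \<Longrightarrow> N y \<le> 1 \<Longrightarrow> N (x - y) \<ge> \<epsilon>' \<Longrightarrow> N (x + y) \<le> 2 - \<delta>"
      using uc unfolding uniformly_convex_ball_def by blast
    have "M (x + y) \<le> 2 - \<delta>" if xy: "M x \<le> 1" "M y \<le> 1" "M (x - y) \<ge> \<epsilon>" for x y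
    proof (rule M_le)
      fix g assume g: "g \<in> carrier G"
      have "\<epsilon> \<le> C * K * norm (x - y)" using xy(3) M_up[of "x - y"] by linarith
      also have "\<dots> \<le> C * K * (K * norm (\<pi> g (x - y)))"
        using low[OF g, of "x - y"] cC K by (intro mult_left_mono) auto
      finally have "c * \<epsilon> \<le> C * K * K * (c * norm (\<pi> g (x - y)))"
        using cC(1) by (simp add: mult_left_mono mult.assoc mult.left_commute[of _ c])
      also have "\<dots> \<le> C * K * K * N (\<pi> g (x - y))"
        using cC K by (intro mult_left_mono) auto
      finally have "\<epsilon>' \<le> N (\<pi> g (x - y))"
        using cC K by (simp add: \<epsilon>'_def field_simps)
      then have "N (\<pi> g x + \<pi> g y) \<le> 2 - \<delta>"
        using M_ge[OF g, of x] M_ge[OF g, of y] xy by (intro \<delta>(2)) (auto simp: blinfun.diff_right)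
      then show "N (\<pi> g (x + y)) \<le> 2 - \<delta>" by (simp add: blinfun.add_right)
    qed
    with \<delta>(1) show "\<exists>\<delta>>0. \<forall>x y. M x \<le> 1 \<longrightarrow> M y \<le> 1 \<longrightarrow> M (x - y) \<ge> \<epsilon> \<longrightarrow> M (x + y) \<le> 2 - \<delta>"
      by blast
  qed
  have inv_le: "M (\<pi> g x) \<le> M x" if g: "g \<in> carrier G" for g x
  proof (rule M_le)
    fix h assume h: "h \<in> carrier G"
    show "N (\<pi> h (\<pi> g x)) \<le> M x" using M_ge[of "h \<otimes>\<^bsub>G\<^esub> g" x] mult[OF h g] g h by simp
  qed
  show "M (\<pi> g x) = M x" if g: "g \<in> carrier G"
    using inv_le[OF g, of x] inv_le[of "inv\<^bsub>G\<^esub> g" "\<pi> g x"] mult[of "inv\<^bsub>G\<^esub> g" g x] g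
    by (simp add: one)
qed

section \<open>Words and geodesics\<close>

context group
begin

definition word_value :: "'a list \<Rightarrow> 'a" where
  "word_value w = foldr (mult G) w \<one>"

lemma word_value_closed [simp]: "set w \<subseteq> carrier G \<Longrightarrow> word_value w \<in> carrier G"
  by (induction w) (auto simp: word_value_def)

lemma word_value_append:
  "set v \<subseteq> carrier G \<Longrightarrow> set w \<subseteq> carrier G \<Longrightarrow> word_value (v @ w) = word_value v \<otimes> word_value w"
proof (induction v)
  case Nil
  then have "word_value w \<in> carrier G" by simp
  then show ?case by (simp add: word_value_def)
next
  case (Cons a v)
  have *: "word_value (a # u) = a \<otimes> word_value u" for u by (simp add: word_value_def)
  show ?case using Cons by (simp add: * m_assoc)
qed

text \<open>Induction over \<open>generate\<close>; since \<open>S\<close> is closed under inverses,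
  an inverted generator is again a letter.\<close>

lemma symmetric_generating_set_word:
  assumes S: "symmetric_generating_set G S" and g: "g \<in> carrier G"
  shows "\<exists>w. set w \<subseteq> S \<and> word_value w = g"
proof -
  have SG: "S \<subseteq> carrier G" and gen: "generate G S = carrier G"
    using S by (auto simp: symmetric_generating_set_def)
  have letter: "\<exists>w. set w \<subseteq> S \<and> word_value w = s" if "s \<in> S" for s
    using that SG by (intro exI[of _ "[s]"]) (auto simp: word_value_def)
  have "g \<in> generate G S" using g gen by simp
  then show ?thesis
  proof (induction rule: generate.induct)
    case one
    show ?case by (rule exI[of _ "[]"]) (simp add: word_value_def)
  next
    case (incl h)
    then show ?case by (rule letter)
  next
    case (inv h)
    then show ?case using letter assms unfolding symmetric_generating_set_def by blast
  next
    case (eng h1 h2)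
    then obtain v w where "set v \<subseteq> S" "word_value v = h1" "set w \<subseteq> S" "word_value w = h2" by blast
    then show ?case using SG by (intro exI[of _ "v @ w"]) (auto simp: word_value_append)
  qed
qed

lemma word_length_le:
  assumes "set w \<subseteq> S" shows "word_length G S (word_value w) \<le> length w"
  unfolding word_length_def by (rule Least_le) (use assms in \<open>auto simp: word_value_def\<close>)

lemma geodesic_word:
  assumes S: "symmetric_generating_set G S" and g: "g \<in> carrier G"
  obtains w where "set w \<subseteq> S" "word_value w = g" "length w = word_length G S g"
proof -
  have "\<exists>n w. length w = n \<and> set w \<subseteq> S \<and> foldr (mult G) w \<one> = g"
    using symmetric_generating_set_word[OF S g] by (auto simp: word_value_def)
  from LeastI_ex[OF this] that show thesis
    unfolding word_length_def word_value_def by blast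
qed

lemma word_length_mult:
  assumes S: "symmetric_generating_set G S" and g: "g \<in> carrier G" and h: "h \<in> carrier G"
  shows "word_length G S (g \<otimes> h) \<le> word_length G S g + word_length G S h"
proof -
  obtain v where v: "set v \<subseteq> S" "word_value v = g" "length v = word_length G S g"
    using geodesic_word[OF S g] .
  obtain w where w: "set w \<subseteq> S" "word_value w = h" "length w = word_length G S h"
    using geodesic_word[OF S h] .
  have "S \<subseteq> carrier G" using S by (simp add: symmetric_generating_set_def)
  with v w have "word_value (v @ w) = g \<otimes> h" by (metis order_trans word_value_append)
  with word_length_le[of "v @ w" S] v w show ?thesis by simp
qed

text \<open>A shorter word for the middle factor would shorten the whole word. Hence blocks cut from
  a geodesic have exact length.\<close>

lemma geodesic_subword:
  assumes S: "symmetric_generating_set G S" and w: "set (x @ y @ z) \<subseteq> S"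
    and geo: "length (x @ y @ z) = word_length G S (word_value (x @ y @ z))"
  shows "word_length G S (word_value y) = length y"
proof -
  have SG: "S \<subseteq> carrier G" using S by (simp add: symmetric_generating_set_def)
  have sub: "set x \<subseteq> S" "set y \<subseteq> S" "set z \<subseteq> S" using w by auto
  with SG have c: "set x \<subseteq> carrier G" "set y \<subseteq> carrier G" "set z \<subseteq> carrier G" by auto
  let ?l = "word_length G S"
  have "length x + length y + length z = ?l (word_value x \<otimes> (word_value y \<otimes> word_value z))"
    using geo c by (simp add: word_value_append)
  also have "\<dots> \<le> ?l (word_value x) + (?l (word_value y) + ?l (word_value z))"
    using word_length_mult[OF S, of "word_value x" "word_value y \<otimes> word_value z"]
      word_length_mult[OF S, of "word_value y" "word_value z"] c by simp
  also have "\<dots> \<le> length x + (?l (word_value y) + length z)"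
    using word_length_le[OF sub(1)] word_length_le[OF sub(3)] by linarith
  finally show ?thesis using word_length_le[OF sub(2)] by linarith
qed

text \<open>Finiteness lets the c_0 property be used uniformly over all blocks of a given
  length.\<close>

lemma finite_sphere:
  assumes S: "symmetric_generating_set G S" and fin: "finite S"
  shows "finite {g \<in> carrier G. word_length G S g = n}"
proof (rule finite_subset)
  show "{g \<in> carrier G. word_length G S g = n} \<subseteq> word_value ` {w. set w \<subseteq> S \<and> length w = n}"
  proof
    fix g assume "g \<in> {g \<in> carrier G. word_length G S g = n}"
    then have g: "g \<in> carrier G" "word_length G S g = n" by auto
    obtain w where "set w \<subseteq> S" "word_value w = g" "length w = word_length G S g"
      using geodesic_word[OF S g(1)] .
    with g show "g \<in> word_value ` {w. set w \<subseteq> S \<and> length w = n}" by blast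
  qed
  show "finite (word_value ` {w. set w \<subseteq> S \<and> length w = n})"
    using finite_lists_length_eq[OF fin] by blast
qed

end

section \<open>Growth of cocycles\<close>

text \<open>Invariance turns the cocycle identity into subadditivity of \<open>M (b g)\<close>, so a
  bound on the generators gives linear growth along words.\<close>

lemma cocycle_bound:
  fixes \<pi> :: "'g \<Rightarrow> 'e::real_normed_vector \<Rightarrow>\<^sub>L 'e"
  assumes G: "group G" and fin: "finite S" and S: "symmetric_generating_set G S"
    and b: "cocycle G \<pi> b" and M: "is_norm M"
    and inv: "\<And>g x. g \<in> carrier G \<Longrightarrow> M (blinfun_apply (\<pi> g) x) = M x"
  shows "\<exists>B\<ge>0. \<forall>g\<in>carrier G. M (b g) \<le> B * real (word_length G S g)"
proof -
  interpret group G by fact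
  have SG: "S \<subseteq> carrier G" using S by (simp add: symmetric_generating_set_def)
  have coc: "b (g \<otimes>\<^bsub>G\<^esub> h) = b g + \<pi> g (b h)" if "g \<in> carrier G" "h \<in> carrier G" for g h
    using b that by (simp add: cocycle_def)
  have M0: "M x \<ge> 0" for x using M by (simp add: is_norm_def)
  \<comment> \<open>A sum rather than a maximum, so that an empty \<open>S\<close> needs no separate
    case.\<close>
  define B where "B = (\<Sum>s\<in>S. M (b s))"
  have B: "M (b s) \<le> B" if "s \<in> S" for s
    unfolding B_def by (rule member_le_sum) (use that fin M0 in auto)
  \<comment> \<open>The cocycle identity at the neutral element shows that \<pi>(1) kills b(1);
    invariance of \<open>M\<close> removes the operator.\<close>
  have b1: "M (b \<one>\<^bsub>G\<^esub>) = 0"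
  proof -
    have "\<pi> \<one>\<^bsub>G\<^esub> (b \<one>\<^bsub>G\<^esub>) = 0" using coc[of "\<one>\<^bsub>G\<^esub>" "\<one>\<^bsub>G\<^esub>"] by simp
    moreover have "M 0 = 0" using M by (simp add: is_norm_def)
    ultimately show ?thesis using inv[of "\<one>\<^bsub>G\<^esub>" "b \<one>\<^bsub>G\<^esub>"] by simp
  qed
  have words: "M (b (word_value w)) \<le> B * real (length w)" if "set w \<subseteq> S" for w
    using that
  proof (induction w)
    case Nil
    then show ?case using b1 by (simp add: word_value_def)
  next
    case (Cons s w)
    have c: "s \<in> carrier G" "word_value w \<in> carrier G" using Cons.prems SG by auto
    have "b (word_value (s # w)) = b s + \<pi> s (b (word_value w))"
      using coc[OF c] by (simp add: word_value_def)
    then have "M (b (word_value (s # w))) \<le> M (b s) + M (b (word_value w))"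
      using M inv[OF c(1)] unfolding is_norm_def by metis
    with Cons B[of s] show ?case by (simp add: algebra_simps)
  qed
  have "M (b g) \<le> B * real (word_length G S g)" if g: "g \<in> carrier G" for g
  proof -
    obtain w where "set w \<subseteq> S" "word_value w = g" "length w = word_length G S g"
      using geodesic_word[OF S g] .
    with words[of w] show ?thesis by simp
  qed
  moreover have "B \<ge> 0" unfolding B_def by (rule sum_nonneg) (rule M0)
  ultimately show ?thesis by blast
qed

section \<open>The c_0 property against alignment of distant blocks\<close>

lemma c0_uniform_on_finite:
  fixes \<pi> :: "'g \<Rightarrow> 'e::real_normed_vector \<Rightarrow>\<^sub>L 'e" and a :: real
  assumes c0: "c0_representation G \<pi>" and "finite \<Phi>" "finite X" and "a > 0"
  shows "\<exists>R::nat. \<forall>\<phi>\<in>\<Phi>. \<forall>x\<in>X. \<forall>u\<in>carrier G. l u \<ge> R \<longrightarrow> \<bar>blinfun_apply \<phi> (\<pi> u x)\<bar> < a"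
proof -
  \<comment> \<open>By the c_0 property each exceptional set is finite; so is their union, and
    \<open>l\<close> is bounded on it.\<close>
  define E where "E = (\<Union>\<phi>\<in>\<Phi>. \<Union>x\<in>X. {u \<in> carrier G. \<not> \<bar>blinfun_apply \<phi> (\<pi> u x)\<bar> < a})"
  have "finite {u \<in> carrier G. \<not> \<bar>blinfun_apply \<phi> (\<pi> u x)\<bar> < a}" for \<phi> :: "'e \<Rightarrow>\<^sub>L real" and x
  proof -
    have "((\<lambda>g. \<phi> (\<pi> g x)) \<longlongrightarrow> 0) (inf cofinite (principal (carrier G)))"
      using c0 by (simp add: c0_representation_def)
    from tendstoD[OF this \<open>a > 0\<close>] show ?thesis
      by (simp add: eventually_inf_principal eventually_cofinite)
  qed
  then have "finite E" unfolding E_def by (intro finite_UN_I assms)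
  then obtain R where R: "\<And>u. u \<in> E \<Longrightarrow> l u < R"
    using finite_nat_set_iff_bounded[of "l ` E"] by auto
  have "\<bar>blinfun_apply \<phi> (\<pi> u x)\<bar> < a" if "\<phi> \<in> \<Phi>" "x \<in> X" "u \<in> carrier G" "l u \<ge> R" for \<phi> x u
    using R[of u] that unfolding E_def by force
  then show ?thesis by blast
qed

text \<open>Hahn-Banach is applied to \<open>M\<close>; equivalence of the norms makes the
  functional continuous for the original norm, which is what the c_0 property tests against.\<close>

lemma norming_blinfun:
  fixes M :: "'e::real_normed_vector \<Rightarrow> real"
  assumes eq: "equivalent_norm M"
  shows "\<exists>\<phi> :: 'e \<Rightarrow>\<^sub>L real. (\<forall>x. \<phi> x \<le> M x) \<and> \<phi> y = M y"
proof -
  have M: "is_norm M" using eq by (simp add: equivalent_norm_def)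
  obtain C where C: "\<And>x. M x \<le> C * norm x" using eq unfolding equivalent_norm_def by blast
  obtain f where f: "linear f" "\<And>x. f x \<le> M x" "f y = M y"
    using Hahn_Banach_norming[OF is_norm_sublinear[OF M]] by blast
  have "bounded_linear f"
  proof (rule bounded_linear_intro)
    show "f (x + z) = f x + f z" "f (r *\<^sub>R x) = r *\<^sub>R f x" for x z r
      using f(1) by (simp_all add: linear_add linear_scale)
    show "norm (f x) \<le> norm x * C" for x
      using f(2)[of x] f(2)[of "- x"] C[of x] C[of "- x"] f(1) by (simp add: linear_neg mult.commute)
  qed
  with f show ?thesis by (intro exI[of _ "Blinfun f"]) (simp add: bounded_linear_Blinfun_apply)
qed

text \<open>In the application \<open>\<beta> i\<close> is the value of the cocycle after \<open>i\<close> blocks of a geodesic. The sum of all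
  pairs of increments at distance \<open>K\<close> telescopes to \<open>2 \<beta> q\<close> up to two boundary terms.\<close>

lemma aligned_increments:
  fixes \<beta> :: "nat \<Rightarrow> 'e::real_vector"
  assumes M: "is_norm M" and "\<beta> 0 = 0" and "K \<le> q"
    and step: "\<And>i. i < q \<Longrightarrow> M (\<beta> (Suc i) - \<beta> i) \<le> A"
    and small: "\<And>i. i + K < q \<Longrightarrow> M ((\<beta> (Suc i) - \<beta> i) + (\<beta> (Suc (i + K)) - \<beta> (i + K))) \<le> D"
  shows "2 * M (\<beta> q) \<le> real (q - K) * D + 2 * real K * A"
proof -
  define r where "r = q - K"
  have q: "q = r + K" using \<open>K \<le> q\<close> by (simp add: r_def)
  have tri: "M (u + v) \<le> M u + M v" for u v using M by (simp add: is_norm_def)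
  define v where "v = (\<lambda>i. \<beta> (Suc i) - \<beta> i)"
  have tele: "(\<Sum>i<m. v (i + j)) = \<beta> (m + j) - \<beta> j" for m j
    unfolding v_def using sum_lessThan_telescope[of "\<lambda>i. \<beta> (i + j)" m] by simp
  have part: "M (\<beta> (K + j) - \<beta> j) \<le> real K * A" if "j + K \<le> q" for j
  proof -
    have "M (\<beta> (K + j) - \<beta> j) \<le> (\<Sum>i<K. M (v (i + j)))"
      using is_norm_sum[OF M, of "\<lambda>i. v (i + j)" K] by (simp add: tele)
    also have "\<dots> \<le> (\<Sum>i<K. A)" using that by (intro sum_mono) (simp add: v_def step)
    finally show ?thesis by simp
  qed
  have "(\<Sum>i<r. v i + v (i + K)) = \<beta> r + (\<beta> q - \<beta> K)"
    using tele[where m = r and j = 0] tele[where m = r and j = K] \<open>\<beta> 0 = 0\<close> by (simp add: sum.distrib q)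
  moreover have "M (\<Sum>i<r. v i + v (i + K)) \<le> (\<Sum>i<r. D)"
  proof -
    have "(\<Sum>i<r. M (v i + v (i + K))) \<le> (\<Sum>i<r. D)"
      using small by (intro sum_mono) (simp add: v_def q)
    with is_norm_sum[OF M, of "\<lambda>i. v i + v (i + K)" r] show ?thesis by linarith
  qed
  ultimately have 1: "M (\<beta> r + (\<beta> q - \<beta> K)) \<le> real r * D" by simp
  \<comment> \<open>Beyond the sum of pairs there remain the last \<open>K\<close> and the first
    \<open>K\<close> increments, each group of norm at most \<open>real K * A\<close>.\<close>
  have "2 *\<^sub>R \<beta> q = (\<beta> r + (\<beta> q - \<beta> K)) + ((\<beta> (K + r) - \<beta> r) + (\<beta> (K + 0) - \<beta> 0))"
    using \<open>\<beta> 0 = 0\<close> by (simp add: q scaleR_2 add.commute)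
  then have "M (2 *\<^sub>R \<beta> q) \<le> M (\<beta> r + (\<beta> q - \<beta> K)) + (M (\<beta> (K + r) - \<beta> r) + M (\<beta> (K + 0) - \<beta> 0))"
    using tri[of "\<beta> r + (\<beta> q - \<beta> K)" "(\<beta> (K + r) - \<beta> r) + (\<beta> (K + 0) - \<beta> 0)"]
      tri[of "\<beta> (K + r) - \<beta> r" "\<beta> (K + 0) - \<beta> 0"] by simp
  moreover have "M (2 *\<^sub>R \<beta> q) = 2 * M (\<beta> q)" using M by (simp add: is_norm_def)
  ultimately show ?thesis using 1 part[of r] part[of 0] \<open>K \<le> q\<close> by (simp add: q)
qed

text \<open>Two vectors violating the bound would be less than \<open>A / 4\<close> apart, with
  \<open>M (b h)\<close> at least \<open>A / 2\<close>; a functional norming \<open>b h\<close>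
  would then exceed \<open>A / 4\<close> at \<open>\<pi> u (b h')\<close>, which fails for long
  \<open>u\<close>. Here \<delta> is fixed before \<open>A\<close> and \<open>n\<close>, while
  \<open>K\<close> may depend on them.\<close>

lemma no_aligned_blocks:
  fixes \<pi> :: "'g \<Rightarrow> 'e::real_normed_vector \<Rightarrow>\<^sub>L 'e"
  assumes G: "group G" and fin: "finite S" and S: "symmetric_generating_set G S"
    and c0: "c0_representation G \<pi>"
    and eq: "equivalent_norm M" and uc: "uniformly_convex_ball M"
  shows "\<exists>\<delta>>0. \<forall>A n. A > 0 \<longrightarrow> n > 0 \<longrightarrow>
    (\<forall>h\<in>carrier G. word_length G S h = n \<longrightarrow> M (b h) \<le> A) \<longrightarrow>
    (\<exists>K::nat. \<forall>h\<in>carrier G. \<forall>h'\<in>carrier G. \<forall>u\<in>carrier G.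
       word_length G S h = n \<longrightarrow> word_length G S h' = n \<longrightarrow> word_length G S u = K * n \<longrightarrow>
       M (blinfun_apply (\<pi> u) (b h')) = M (b h') \<longrightarrow>
       M (b h + blinfun_apply (\<pi> u) (b h')) \<le> (2 - \<delta>) * A)"
proof -
  interpret group G by fact
  have M: "is_norm M" using eq by (simp add: equivalent_norm_def)
  obtain \<delta>0 where \<delta>0: "\<delta>0 > 0" "\<And>A x y. A > 0 \<Longrightarrow> M x \<le> A \<Longrightarrow> M y \<le> A \<Longrightarrow>
      M (x - y) \<ge> 1 / 4 * A \<Longrightarrow> M (x + y) \<le> (2 - \<delta>0) * A"
    using uniformly_convex_ball_scaled[OF M uc, of "1 / 4"] by (meson zero_less_divide_1_iff zero_less_numeral)
  \<comment> \<open>The cap 1/2 is what yields \<open>M (b h) \<ge> A / 2\<close> from the triangle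
    inequality.\<close>
  define \<delta> where "\<delta> = min \<delta>0 (1 / 2)"
  have \<delta>: "\<delta> > 0" "\<delta> \<le> \<delta>0" "\<delta> \<le> 1 / 2" using \<delta>0 by (auto simp: \<delta>_def)
  have "\<exists>K::nat. \<forall>h\<in>carrier G. \<forall>h'\<in>carrier G. \<forall>u\<in>carrier G.
       word_length G S h = n \<longrightarrow> word_length G S h' = n \<longrightarrow> word_length G S u = K * n \<longrightarrow>
       M (\<pi> u (b h')) = M (b h') \<longrightarrow> M (b h + \<pi> u (b h')) \<le> (2 - \<delta>) * A"
    if A: "A > 0" and n: "n > 0"
      and bA: "\<And>h. h \<in> carrier G \<Longrightarrow> word_length G S h = n \<Longrightarrow> M (b h) \<le> A" for A n
  proof -
    define F where "F = {h \<in> carrier G. word_length G S h = n}"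
    have "finite F" unfolding F_def by (rule finite_sphere[OF S fin])
    have "\<forall>h. \<exists>\<phi> :: 'e \<Rightarrow>\<^sub>L real. (\<forall>x. \<phi> x \<le> M x) \<and> \<phi> (b h) = M (b h)"
      using norming_blinfun[OF eq] by blast
    from choice[OF this]
    obtain \<phi> :: "'g \<Rightarrow> 'e \<Rightarrow>\<^sub>L real" where \<phi>: "\<And>h x. \<phi> h x \<le> M x" "\<And>h. \<phi> h (b h) = M (b h)"
      by blast
    obtain R where "\<forall>\<psi>\<in>\<phi> ` F. \<forall>x\<in>b ` F. \<forall>u\<in>carrier G.
        word_length G S u \<ge> R \<longrightarrow> \<bar>blinfun_apply \<psi> (\<pi> u x)\<bar> < A / 4"
      using c0_uniform_on_finite[OF c0, of "\<phi> ` F" "b ` F" "A / 4"] A \<open>finite F\<close>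
      by (meson divide_pos_pos finite_imageI zero_less_numeral)
    then have R: "\<bar>\<phi> h (\<pi> u (b h'))\<bar> < A / 4"
      if "h \<in> F" "h' \<in> F" "u \<in> carrier G" "word_length G S u \<ge> R" for h h' u
      using that by blast
    have "M (b h + \<pi> u (b h')) \<le> (2 - \<delta>) * A"
      if h: "h \<in> F" and h': "h' \<in> F" and u: "u \<in> carrier G" "word_length G S u = R * n"
        and iso: "M (\<pi> u (b h')) = M (b h')" for h h' u
    proof (rule ccontr)
      assume "\<not> M (b h + \<pi> u (b h')) \<le> (2 - \<delta>) * A"
      then have big: "M (b h + \<pi> u (b h')) > (2 - \<delta>) * A" by simp
      have le: "M (b h) \<le> A" "M (\<pi> u (b h')) \<le> A" using bA h h' iso by (auto simp: F_def)
      have dA: "\<delta> * A \<le> \<delta>0 * A" "\<delta> * A \<le> 1 / 2 * A" using \<delta> A by (auto intro!: mult_right_mono)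
      have "M (b h - \<pi> u (b h')) < 1 / 4 * A"
      proof (rule ccontr)
        assume "\<not> M (b h - \<pi> u (b h')) < 1 / 4 * A"
        then have "M (b h + \<pi> u (b h')) \<le> (2 - \<delta>0) * A" by (intro \<delta>0(2) A le) simp
        with big dA show False by (simp add: left_diff_distrib)
      qed
      moreover have "M (b h) \<ge> A / 2"
      proof -
        have "M (b h + \<pi> u (b h')) \<le> M (b h) + M (\<pi> u (b h'))" using M by (simp add: is_norm_def)
        with big le dA show ?thesis by (simp add: left_diff_distrib)
      qed
      moreover have "\<phi> h (b h) - \<phi> h (\<pi> u (b h')) \<le> M (b h - \<pi> u (b h'))"
        using \<phi>(1)[of h "b h - \<pi> u (b h')"] by (simp add: blinfun.diff_right)
      moreover have "R \<le> R * n" using n by simp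
      then have "\<bar>\<phi> h (\<pi> u (b h'))\<bar> < A / 4" using R[OF h h' u(1)] u(2) by simp
      ultimately show False using \<phi>(2)[of h] by linarith
    qed
    then show ?thesis by (intro exI[of _ R] ballI impI) (simp_all add: F_def)
  qed
  then show ?thesis using \<delta>(1) by (intro exI[of _ \<delta>] conjI allI impI) simp_all
qed

text \<open>The constants are chosen in the order \<delta>, \<theta>, \<open>n\<close>,
  \<open>K\<close>, \<open>Q\<close>, and only then the element \<open>g\<close>: it must be long
  enough to make the boundary terms, which depend on \<open>n\<close> and \<open>K\<close>,
  negligible.\<close>

lemma cocycle_sublinear_invariant_norm:
  fixes \<pi> :: "'g \<Rightarrow> 'e::real_normed_vector \<Rightarrow>\<^sub>L 'e"
  assumes G: "group G" and fin: "finite S" and S: "symmetric_generating_set G S"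
    and \<pi>: "linear_representation G \<pi>" and c0: "c0_representation G \<pi>" and b: "cocycle G \<pi> b"
    and eq: "equivalent_norm M" and uc: "uniformly_convex_ball M"
    and inv: "\<And>g x. g \<in> carrier G \<Longrightarrow> M (blinfun_apply (\<pi> g) x) = M x"
    and "\<epsilon> > 0"
  shows "\<exists>N. \<forall>g\<in>carrier G. word_length G S g \<ge> N \<longrightarrow> M (b g) \<le> \<epsilon> * real (word_length G S g)"
proof (rule ccontr)
  interpret group G by fact
  have SG: "S \<subseteq> carrier G" using S by (simp add: symmetric_generating_set_def)
  have M: "is_norm M" using eq by (simp add: equivalent_norm_def)
  define l where "l = word_length G S"
  \<comment> \<open>\<open>T\<close> collects the eventual linear rates; its infimum
    \<open>c\<close> below is the limsup of \<open>M (b g) / l g\<close>.\<close>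
  define T where "T = {c. \<exists>N. \<forall>g\<in>carrier G. l g \<ge> N \<longrightarrow> M (b g) \<le> c * real (l g)}"
  assume "\<not> (\<exists>N. \<forall>g\<in>carrier G. word_length G S g \<ge> N \<longrightarrow> M (b g) \<le> \<epsilon> * real (word_length G S g))"
  then have "\<epsilon> \<notin> T" by (simp add: T_def l_def)
  have up: "c' \<in> T" if "c \<in> T" "c \<le> c'" for c c'
  proof -
    have "c * real (l g) \<le> c' * real (l g)" for g using that by (intro mult_right_mono) auto
    with that(1) show ?thesis unfolding T_def by (blast intro: order_trans)
  qed
  have T_gt: "\<epsilon> < c" if "c \<in> T" for c using up[OF that, of \<epsilon>] \<open>\<epsilon> \<notin> T\<close> by force
  obtain B where B: "B \<ge> 0" "\<And>g. g \<in> carrier G \<Longrightarrow> M (b g) \<le> B * real (l g)"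
    using cocycle_bound[OF G fin S b M inv] unfolding l_def by blast
  then have "B \<in> T" by (auto simp: T_def)
  define c where "c = Inf T"
  have "\<epsilon> \<le> c" unfolding c_def by (rule cInf_greatest) (use \<open>B \<in> T\<close> T_gt in \<open>auto intro: less_imp_le\<close>)
  with \<open>\<epsilon> > 0\<close> have "c > 0" by simp
  have bdd: "bdd_below T" by (rule bdd_belowI[of _ \<epsilon>]) (use T_gt in \<open>auto intro: less_imp_le\<close>)

  obtain \<delta> where \<delta>: "\<delta> > 0" and K_ex: "\<And>A n. A > 0 \<Longrightarrow> n > 0 \<Longrightarrow>
    (\<forall>h\<in>carrier G. l h = n \<longrightarrow> M (b h) \<le> A) \<Longrightarrow>
    (\<exists>K::nat. \<forall>h\<in>carrier G. \<forall>h'\<in>carrier G. \<forall>u\<in>carrier G.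
       l h = n \<longrightarrow> l h' = n \<longrightarrow> l u = K * n \<longrightarrow>
       M (\<pi> u (b h')) = M (b h') \<longrightarrow> M (b h + \<pi> u (b h')) \<le> (2 - \<delta>) * A)"
    using no_aligned_blocks[OF G fin S c0 eq uc, of b] unfolding l_def by blast
  define \<theta> where "\<theta> = min \<delta> 1 / 8"
  define c1 c2 where "c1 = c * (1 + \<theta>)" and "c2 = c * (1 - \<theta>)"
  have \<theta>: "\<theta> > 0" "\<theta> < 1" "8 * \<theta> \<le> \<delta>" using \<delta> by (auto simp: \<theta>_def)
  with \<open>c > 0\<close> have c1: "c1 > c" "c1 > 0" and c2: "c2 < c" "c2 \<ge> 0" by (simp_all add: c1_def c2_def)
  \<comment> \<open>The gap between twice the attained rate \<open>c2\<close> and the rate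
    \<open>(2 - \<delta>) * c1\<close> that unaligned pairs of blocks would allow; \<theta> being at
    most \<delta>/8 makes it positive.\<close>
  define \<kappa> where "\<kappa> = 2 * c2 - (2 - \<delta>) * c1"
  have "\<kappa> = c * ((\<delta> - 4 * \<theta>) + \<delta> * \<theta>)" by (simp add: \<kappa>_def c1_def c2_def algebra_simps)
  moreover have "(\<delta> - 4 * \<theta>) + \<delta> * \<theta> > 0" using \<delta> \<theta> by (intro add_pos_pos) auto
  ultimately have "\<kappa> > 0" using \<open>c > 0\<close> by simp

  have "c1 \<in> T"
  proof -
    obtain c' where "c' \<in> T" "c' < c1"
      using c1(1) cInf_lessD[of T c1] \<open>B \<in> T\<close> unfolding c_def by blast
    with up show ?thesis by simp
  qed
  then obtain N where N: "\<And>g. g \<in> carrier G \<Longrightarrow> l g \<ge> N \<Longrightarrow> M (b g) \<le> c1 * real (l g)"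
    unfolding T_def by blast
  \<comment> \<open>Positive and past the threshold \<open>N\<close>, so that the rate
    \<open>c1\<close> bounds all blocks of length \<open>n\<close>.\<close>
  define n where "n = Suc N"
  define A where "A = c1 * real n"
  have n: "n > 0" and A: "A > 0" using c1 by (auto simp: n_def A_def)
  have bA: "M (b h) \<le> A" if "h \<in> carrier G" "l h = n" for h
    using N[of h] that by (simp add: A_def n_def)
  obtain K where K: "\<And>h h' u. h \<in> carrier G \<Longrightarrow> h' \<in> carrier G \<Longrightarrow> u \<in> carrier G \<Longrightarrow>
       l h = n \<Longrightarrow> l h' = n \<Longrightarrow> l u = K * n \<Longrightarrow> M (b h + \<pi> u (b h')) \<le> (2 - \<delta>) * A"
    using K_ex[OF A n] bA inv by metis

  \<comment> \<open>After division by \<open>n\<close>, the term \<open>2 * B\<close> pays for the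
    incomplete last block and \<open>\<delta> * c1 * real K\<close> for the boundary
    increments.\<close>
  obtain Q :: nat where Q: "2 * B + \<delta> * c1 * real K < real Q * \<kappa>"
    using ex_less_of_nat_mult[OF \<open>\<kappa> > 0\<close>] by blast
  \<comment> \<open>Being below the infimum of \<open>T\<close>, the rate \<open>c2\<close> is
    exceeded at arbitrarily large lengths; the length asked for gives at least \<open>Q\<close> and
    at least \<open>K\<close> full blocks.\<close>
  have "c2 \<notin> T" using c2 cInf_lower[OF _ bdd, of c2] unfolding c_def by auto
  then obtain g where g: "g \<in> carrier G" "l g \<ge> (Q + K) * n" and gbig: "M (b g) > c2 * real (l g)"
    unfolding T_def by (auto simp: not_le)
  obtain w where w: "set w \<subseteq> S" "word_value w = g" "length w = l g"
    using geodesic_word[OF S g(1)] unfolding l_def .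
  define q where "q = l g div n"
  have "(Q + K) * n div n \<le> q" unfolding q_def by (rule div_le_mono[OF g(2)])
  then have q: "K \<le> q" "Q \<le> q" using n by simp_all
  have qn: "q * n \<le> l g" "l g < q * n + n"
    using n div_mult_mod_eq[of "l g" n] mod_less_divisor[of n "l g"] unfolding q_def by linarith+
  \<comment> \<open>\<open>x i j\<close> is the product of \<open>j\<close> consecutive blocks from
    block \<open>i\<close> on, counted from 0: \<open>x 0 i\<close> is a prefix,
    \<open>x i 1\<close> a block, and \<open>x i K\<close> the element leading from block
    \<open>i\<close> to block \<open>i + K\<close>.\<close>
  define x where "x = (\<lambda>i j. word_value (take (j * n) (drop (i * n) w)))"
  have wG: "set (take j (drop i w)) \<subseteq> carrier G" for i j
    using w(1) SG by (meson order_trans set_drop_subset set_take_subset)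
  have xG: "x i j \<in> carrier G" for i j unfolding x_def by (rule word_value_closed[OF wG])
  have xl: "l (x i j) = j * n" if "i + j \<le> q" for i j
  proof -
    have "(i + j) * n \<le> q * n" using that by (rule mult_right_mono) simp
    with qn have len: "i * n + j * n \<le> length w" using w(3) by (simp add: algebra_simps)
    have split: "take (i * n) w @ take (j * n) (drop (i * n) w) @ drop (j * n) (drop (i * n) w) = w"
      by (simp only: append_take_drop_id)
    have "word_length G S (x i j) = length (take (j * n) (drop (i * n) w))"
      unfolding x_def
      by (rule geodesic_subword[OF S, of "take (i * n) w" _ "drop (j * n) (drop (i * n) w)"])
        (simp_all only: split w l_def)
    with len show ?thesis by (simp add: l_def)
  qed
  have x_mult: "x i (j + k) = x i j \<otimes>\<^bsub>G\<^esub> x (i + j) k" for i j k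
  proof -
    have "take ((j + k) * n) (drop (i * n) w)
        = take (j * n) (drop (i * n) w) @ take (k * n) (drop ((i + j) * n) w)"
      by (simp add: take_add add_mult_distrib add.commute)
    then show ?thesis unfolding x_def using word_value_append[OF wG wG] by simp
  qed
  have coc: "b (g \<otimes>\<^bsub>G\<^esub> h) = b g + \<pi> g (b h)" if "g \<in> carrier G" "h \<in> carrier G" for g h
    using b that by (simp add: cocycle_def)
  define \<beta> where "\<beta> = (\<lambda>i. b (x 0 i))"
  have incr: "\<beta> (Suc i) - \<beta> i = \<pi> (x 0 i) (b (x i 1))" for i
    using x_mult[of 0 i 1] coc[OF xG xG, of 0 i i 1] by (simp add: \<beta>_def)
  have "2 * M (\<beta> q) \<le> real (q - K) * ((2 - \<delta>) * A) + 2 * real K * A"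
  proof (rule aligned_increments[OF M _ q(1)])
    have "M (\<beta> 0) \<le> B * real (l (x 0 0))" unfolding \<beta>_def by (rule B(2)[OF xG])
    then have "M (\<beta> 0) \<le> 0" using xl[of 0 0] by simp
    then show "\<beta> 0 = 0" using M unfolding is_norm_def by (metis order_antisym)
    show "M (\<beta> (Suc i) - \<beta> i) \<le> A" if "i < q" for i
      using bA[OF xG, of i 1] xl[of i 1] that by (simp add: incr inv[OF xG])
    show "M ((\<beta> (Suc i) - \<beta> i) + (\<beta> (Suc (i + K)) - \<beta> (i + K))) \<le> (2 - \<delta>) * A" if "i + K < q" for i
    proof -
      \<comment> \<open>Factoring out \<open>\<pi> (x 0 i)\<close>, which preserves
        \<open>M\<close>, leaves a pair of the shape \<open>b h + \<pi> u (b h')\<close> with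
        \<open>u = x i K\<close>.\<close>
      have "\<pi> (x 0 (i + K)) y = \<pi> (x 0 i) (\<pi> (x i K) y)" for y
        using x_mult[of 0 i K] linear_representation_mult[OF \<pi> xG xG] by simp
      then have "(\<beta> (Suc i) - \<beta> i) + (\<beta> (Suc (i + K)) - \<beta> (i + K))
          = \<pi> (x 0 i) (b (x i 1) + \<pi> (x i K) (b (x (i + K) 1)))"
        by (simp only: incr blinfun.add_right)
      moreover have "M (b (x i 1) + \<pi> (x i K) (b (x (i + K) 1))) \<le> (2 - \<delta>) * A"
        using that by (intro K xG) (simp_all add: xl)
      ultimately show ?thesis by (simp only: inv[OF xG])
    qed
  qed
  moreover have "M (b g) \<le> M (\<beta> q) + B * real n"
  proof -
    \<comment> \<open>The remainder after \<open>q\<close> full blocks, with fewer than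
      \<open>n\<close> letters.\<close>
    define z where "z = word_value (drop (q * n) w)"
    have dG: "set (drop (q * n) w) \<subseteq> carrier G"
      using w(1) SG by (meson order_trans set_drop_subset)
    have zG: "z \<in> carrier G" unfolding z_def by (rule word_value_closed[OF dG])
    have "set (drop (q * n) w) \<subseteq> S" using w(1) by (meson order_trans set_drop_subset)
    from word_length_le[OF this] have "l z \<le> n" using qn w(3) by (simp add: z_def l_def)
    have "g = x 0 q \<otimes>\<^bsub>G\<^esub> z"
      using word_value_append[OF wG[of "q * n" 0] dG] w(2) by (simp add: x_def z_def)
    then have "b g = \<beta> q + \<pi> (x 0 q) (b z)" using coc[OF xG zG] by (simp add: \<beta>_def)
    then have "M (b g) \<le> M (\<beta> q) + M (b z)" using M inv[OF xG] unfolding is_norm_def by metis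
    moreover have "M (b z) \<le> B * real n"
      using B(2)[OF zG] mult_left_mono[OF _ B(1), of "real (l z)" "real n"] \<open>l z \<le> n\<close> by simp
    ultimately show ?thesis by simp
  qed
  moreover have "c2 * (real q * real n) \<le> c2 * real (l g)"
    using qn(1) c2(2) by (intro mult_left_mono) (simp_all flip: of_nat_mult)
  ultimately have "2 * (c2 * (real q * real n))
      \<le> (real q - real K) * ((2 - \<delta>) * A) + 2 * real K * A + 2 * (B * real n)"
    using gbig q(1) by (simp add: of_nat_diff)
  \<comment> \<open>The terms in \<open>q\<close> combine to \<kappa>; those in \<open>K\<close>
    leave the coefficient 2 - (2 - \<delta>) = \<delta>.\<close>
  then have "real n * (real q * \<kappa>) \<le> real n * (2 * B + \<delta> * c1 * real K)"
    by (simp add: A_def \<kappa>_def algebra_simps)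
  then have "real q * \<kappa> \<le> 2 * B + \<delta> * c1 * real K" using n by simp
  moreover have "real Q * \<kappa> \<le> real q * \<kappa>" using q(2) \<open>\<kappa> > 0\<close> by simp
  ultimately show False using Q by simp
qed

theorem theorem1:
  fixes G :: "('g, 'm) monoid_scheme"
    and S :: "'g set"
    and \<pi> :: "'g \<Rightarrow> 'e::banach \<Rightarrow>\<^sub>L 'e"
    and b :: "'g \<Rightarrow> 'e"
  assumes "group G"
    and "finite S"
    and "symmetric_generating_set G S"
    and "superreflexive TYPE('e)"
    and "linear_representation G \<pi>"
    and "uniformly_bounded G \<pi>"
    and "c0_representation G \<pi>"
    and "cocycle G \<pi> b"
  shows "sublinear_growth G S b"
proof -
  obtain N0 :: "'e \<Rightarrow> real" where N0: "equivalent_norm N0" "uniformly_convex_norm N0"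
    using assms(4) unfolding superreflexive_def by blast
  have ball: "uniformly_convex_ball N0"
    by (rule uniformly_convex_ballI) (use N0 in \<open>auto simp: equivalent_norm_def\<close>)
  define M where "M = orbit_norm G \<pi> N0"
  note M = orbit_norm_properties[OF assms(1,5,6) N0(1) ball, folded M_def]
  obtain a where a: "a > 0" "\<And>x. a * norm x \<le> M x"
    using M(1) unfolding equivalent_norm_def by blast
  show ?thesis unfolding sublinear_growth_def
  proof (intro allI impI)
    fix \<epsilon> :: real assume "\<epsilon> > 0"
    \<comment> \<open>The rate \<open>a * \<epsilon>\<close> absorbs the constant lost in returning
      from \<open>M\<close> to the original norm.\<close>
    with a have "a * \<epsilon> > 0" by simp
    then obtain N where N: "\<And>g. g \<in> carrier G \<Longrightarrow> word_length G S g \<ge> N \<Longrightarrow>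
        M (b g) \<le> a * \<epsilon> * real (word_length G S g)"
      using cocycle_sublinear_invariant_norm[OF assms(1,2,3,5,7,8) M] by blast
    have "norm (b g) \<le> \<epsilon> * real (word_length G S g)"
      if "g \<in> carrier G" "word_length G S g \<ge> N" for g
    proof -
      have "a * norm (b g) \<le> a * (\<epsilon> * real (word_length G S g))"
        using a(2)[of "b g"] N[OF that] by (simp add: mult.assoc)
      with a(1) show ?thesis by simp
    qed
    then show "\<exists>N. \<forall>g\<in>carrier G. N \<le> word_length G S g \<longrightarrow>
        norm (b g) \<le> \<epsilon> * real (word_length G S g)" by blast
  qed
qed

end
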